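(* Let $\mathcal{A}=\{a_1,\dots,a_n\}\subset\mathbb{N}^m$ with $\ker_{\mathbb{Z}}(A)\cap\mathbb{N}^n=\{0\}$, where $A$ is the $m\times n$ matrix with columns $a_1,\dots,a_n$, let $\mathcal{B}=\{a_1,\dots,a_s\}\subset\mathcal{A}$, and let $r\ge2$. Then the universal Markov bases of the $r$-th Lawrence liftings of $\mathcal{A}$ and $\mathcal{B}$ satisfy $$\mathcal{M}(\mathcal{B}^{(r)})=\mathcal{M}(\mathcal{A}^{(r)})\cap\mathcal{L}(\mathcal{B}^{(r)}),$$ where $\mathcal{L}(\mathcal{B}^{(r)})$ and $\mathcal{M}(\mathcal{B}^{(r)})$ are regarded as subsets of $\mathcal{L}(\mathcal{A}^{(r)})$ by appending $n-s$ zero columns to $r\times s$ matrices.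
   Context: Here $0\in\mathbb{N}$. For an integer matrix $M$ with $N$ columns and nonnegative entries such that $\ker_{\mathbb{Z}}(M)\cap\mathbb{N}^N=\{0\}$, a Markov basis of $M$ is a finite subset $\mathcal{M}\subset\ker_{\mathbb{Z}}(M)$ such that for all $w,u\in\mathbb{N}^N$ with $w-u\in\ker_{\mathbb{Z}}(M)$ there is a finite sequence $v_1,\dots,v_t$ of elements which up to sign belong to $\mathcal{M}$ (repetitions allowed), with $w-u=\sum_{i=1}^t v_i$ and $w-\sum_{i=1}^p v_i\in\mathbb{N}^N$ for all $1\le p\le t$. A Markov basis is minimal if no proper subset of it is a Markov basis. The universal Markov basis of $M$ is the union of all minimal Markov bases of $M$, where elements differing by a sign are identified. For $r\ge 2$ the $r$-th Lawrence lifting $A^{(r)}$ of an $m\times n$ matrix $A$ is the $(rm+n)\times rn$ matrix whose first $rm$ rows form the block diagonal matrix with $r$ diagonal blocks equal to $A$, and whose last $n$ rows are $(I_n\ I_n\ \cdots\ I_n)$. Write $\mathcal{L}(\mathcal{A}^{(r)})=\ker_{\mathbb{Z}}(A^{(r)})$ and let $\mathcal{M}(\mathcal{A}^{(r)})$ be the universal Markov basis of $A^{(r)}$; similarly for $\mathcal{B}$, using the $m\times s$ matrix with columns $a_1,\dots,a_s$. An element of $\mathcal{L}(\mathcal{A}^{(r)})$ is identified with an $r\times n$ integer matrix each of whose rows lies in $\ker_{\mathbb{Z}}(A)$ and whose rows sum to zero. For $u\in\mathcal{L}(\mathcal{B}^{(r)})$, an $r\times s$ matrix, let $\sigma(u)\in\mathcal{L}(\mathcal{A}^{(r)})$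 be the $r\times n$ matrix whose first $s$ columns are those of $u$ and whose last $n-s$ columns are zero. In the claim, $\mathcal{L}(\mathcal{B}^{(r)})$ and $\mathcal{M}(\mathcal{B}^{(r)})$ stand for their images under $\sigma$. *)

theory Defs
  imports "Jordan_Normal_Form.Matrix_Kernel"
begin

definition nonneg_vecs :: "nat \<Rightarrow> int vec set" where
  "nonneg_vecs N = {w \<in> carrier_vec N. \<forall>i<N. 0 \<le> w $ i}"

definition vec_sum :: "nat \<Rightarrow> int vec list \<Rightarrow> int vec" where
  "vec_sum N vs = foldr (+) vs (0\<^sub>v N)"

(* The list vs is the sequence v_1, ..., v_t; the empty list (t = 0) is the path from w to u = w. *)
definition markov_basis :: "int mat \<Rightarrow> int vec set \<Rightarrow> bool" where
  "markov_basis M S \<longleftrightarrow>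
     finite S \<and> S \<subseteq> mat_kernel M \<and>
     (\<forall>w \<in> nonneg_vecs (dim_col M). \<forall>u \<in> nonneg_vecs (dim_col M).
        w - u \<in> mat_kernel M \<longrightarrow>
        (\<exists>vs. (\<forall>v \<in> set vs. v \<in> S \<or> - v \<in> S) \<and>
              w - u = vec_sum (dim_col M) vs \<and>
              (\<forall>p \<in> {1..length vs}.
                 w - vec_sum (dim_col M) (take p vs) \<in> nonneg_vecs (dim_col M))))"

definition minimal_markov_basis :: "int mat \<Rightarrow> int vec set \<Rightarrow> bool" where
  "minimal_markov_basis M S \<longleftrightarrow>
     markov_basis M S \<and> (\<forall>T. T \<subset> S \<longrightarrow> \<not> markov_basis M T)"

(* Elements differing by a sign are identified by passing to the classes {x, -x}. *)
definition up_to_sign :: "'a::uminus set \<Rightarrow> 'a set set" where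
  "up_to_sign S = (\<lambda>x. {x, - x}) ` S"

definition universal_markov_basis :: "int mat \<Rightarrow> int vec set set" where
  "universal_markov_basis M = up_to_sign (\<Union> {S. minimal_markov_basis M S})"

definition lawrence_lifting :: "nat \<Rightarrow> int mat \<Rightarrow> int mat" where
  "lawrence_lifting r A =
     (let n = dim_col A
      in diag_block_mat (replicate r A) @\<^sub>r
         mat n (r * n) (\<lambda>(i, j). if j mod n = i then 1 else 0))"

(* Identification of Z^(r n) with r x n matrices: row i consists of the coordinates
   belonging to the i-th diagonal block of the lifting. *)
definition block_rows :: "nat \<Rightarrow> nat \<Rightarrow> int vec \<Rightarrow> int mat" where
  "block_rows r n v = mat r n (\<lambda>(i, j). v $ (i * n + j))"

definition lawrence_lattice :: "nat \<Rightarrow> int mat \<Rightarrow> int mat set" where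
  "lawrence_lattice r A = block_rows r (dim_col A) ` mat_kernel (lawrence_lifting r A)"

(* A set of sign classes {U, -U} of r x n matrices. *)
definition lawrence_universal_markov :: "nat \<Rightarrow> int mat \<Rightarrow> int mat set set" where
  "lawrence_universal_markov r A =
     (\<lambda>c. block_rows r (dim_col A) ` c) ` universal_markov_basis (lawrence_lifting r A)"

(* The map sigma; n is the total number of columns after padding. *)
definition append_zero_cols :: "nat \<Rightarrow> int mat \<Rightarrow> int mat" where
  "append_zero_cols n U =
     mat (dim_row U) n (\<lambda>(i, j). if j < dim_col U then U $$ (i, j) else 0)"

end

theory Submission
  imports Defs
begin

text \<open>
  Write \<open>v = v\<^sup>+ - v\<^sup>-\<close> for the decomposition of a vector into its positive and negative parts.
  The columns of an element of the kernel of a Lawrence lifting sum to zero, so the sum of all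
  coordinates is constant on every fibre of nonnegative vectors, and it grades the kernel by
  \<open>height v\<close>, the coordinate sum of \<open>v\<^sup>+\<close>.  For lattices graded in this way, membership in the
  universal Markov basis is an intrinsic property of \<open>v\<close>: it holds iff \<open>v\<^sup>+\<close> and \<open>v\<^sup>-\<close> cannot be joined
  by nonnegative moves of height smaller than that of \<open>v\<close> (\<open>indecomposable\<close>, \<open>Union_minimal_markov\<close>).

  In one direction, if such moves join \<open>v\<^sup>+\<close> and \<open>v\<^sup>-\<close>, then a Markov basis containing \<open>v\<close> replaces
  each of them by its own elements of the same or smaller height, so \<open>v\<close> is superfluous.
  In the other, take a Markov basis of least size among those containing \<open>v\<close>; one exists by
  Dickson's lemma.  If it stayed Markov without \<open>v\<close>, a walk from \<open>v\<^sup>+\<close> to \<open>v\<^sup>-\<close> in the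
  rest could not use small moves only, and the top-height element that it uses can be exchanged for \<open>v\<close>
  (\<open>exchange\<close>), which contradicts the choice.

  The criterion only looks at the fibre of \<open>v\<^sup>+\<close>.  For \<open>\<sigma>(v)\<close> this fibre consists of nonnegative matrices
  whose last columns sum to zero, hence vanish: it is the image under \<open>\<sigma>\<close> of the
  fibre of \<open>v\<^sup>+\<close>, with the same moves and the same heights.  So \<open>v\<close> and \<open>\<sigma>(v)\<close> are indecomposable
  together (\<open>embed_indecomposable_iff\<close>), which is the claim.
\<close>

section \<open>Connectivity by nonnegative moves\<close>

definition pos_part :: "int vec \<Rightarrow> int vec" where
  "pos_part g = vec (dim_vec g) (\<lambda>i. max 0 (g $ i))"

definition total :: "int vec \<Rightarrow> int" where
  "total x = (\<Sum>i<dim_vec x. x $ i)"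

text \<open>
  For kernel elements this is the degree of the fibre in which the move joins
  disjointly supported vectors; in every other fibre that it acts on, the degree is larger.
\<close>
definition height :: "int vec \<Rightarrow> int" where
  "height g = total (pos_part g)"

definition move :: "nat \<Rightarrow> int vec set \<Rightarrow> int vec \<Rightarrow> int vec \<Rightarrow> bool" where
  "move N G x y \<longleftrightarrow>
     x \<in> nonneg_vecs N \<and> y \<in> nonneg_vecs N \<and> (x - y \<in> G \<or> y - x \<in> G)"

abbreviation linked :: "nat \<Rightarrow> int vec set \<Rightarrow> int vec \<Rightarrow> int vec \<Rightarrow> bool" where
  "linked N G \<equiv> (move N G)\<^sup>*\<^sup>*"

lemma nonneg_vecs_iff:
  "x \<in> nonneg_vecs N \<longleftrightarrow> dim_vec x = N \<and> (\<forall>i<N. 0 \<le> x $ i)"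
  by (auto simp: nonneg_vecs_def)

lemma dim_pos_part [simp]: "dim_vec (pos_part g) = dim_vec g"
  by (simp add: pos_part_def)

lemma index_pos_part [simp]: "i < dim_vec g \<Longrightarrow> pos_part g $ i = max 0 (g $ i)"
  by (simp add: pos_part_def)

lemma pos_part_nonneg: "g \<in> carrier_vec N \<Longrightarrow> pos_part g \<in> nonneg_vecs N"
  by (auto simp: nonneg_vecs_iff)

lemma pos_part_diff: "g \<in> carrier_vec N \<Longrightarrow> pos_part g - pos_part (- g) = g"
  by (intro eq_vecI) auto

lemma move_sym: "move N G x y \<Longrightarrow> move N G y x"
  by (auto simp: move_def)

lemma linked_sym: "linked N G x y \<Longrightarrow> linked N G y x"
  using sympD[OF symp_rtranclp[OF sympI[of "move N G"]]] move_sym by blast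

lemma linked_mono: "linked N G x y \<Longrightarrow> G \<subseteq> H \<Longrightarrow> linked N H x y"
  by (rule rtranclp_mono[THEN predicate2D, of "move N G"]) (auto simp: move_def)

lemma linked_move:
  assumes "x \<in> nonneg_vecs N" "y \<in> nonneg_vecs N" "x - y \<in> G"
  shows "linked N G x y"
  using assms by (auto simp: move_def)

lemma linked_shift:
  assumes "linked N G x y" "e \<in> nonneg_vecs N"
  shows "linked N G (x + e) (y + e)"
  using assms(1)
proof (induction rule: rtranclp_induct)
  case (step y z)
  have "(y + e) - (z + e) = y - z" "(z + e) - (y + e) = z - y"
    using step.hyps(2) assms(2)
    by (auto simp: move_def nonneg_vecs_iff intro!: eq_vecI)
  hence "move N G (y + e) (z + e)"
    using step.hyps(2) assms(2) by (auto simp: move_def nonneg_vecs_iff)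
  with step.IH show ?case by (rule rtranclp.rtrancl_into_rtrancl)
qed simp

text \<open>
  A move by g from x takes away the positive part of g and puts the negative part back; the
  remainder of x is a spectator.  So everything reduces to joining the two parts of each g.
\<close>
lemma move_decompose:
  assumes "x \<in> nonneg_vecs N" "y \<in> nonneg_vecs N"
  defines "g \<equiv> x - y" and "e \<equiv> x - pos_part (x - y)"
  shows "e \<in> nonneg_vecs N" "x = pos_part g + e" "y = pos_part (- g) + e"
  using assms(1,2) unfolding g_def e_def
  by (auto simp: nonneg_vecs_iff intro!: eq_vecI)

lemma linked_replace:
  assumes "linked N G x y"
    and H: "\<And>g. g \<in> G \<Longrightarrow> linked N H (pos_part g) (pos_part (- g))"
  shows "linked N H x y"
  using assms(1)
proof (induction rule: rtranclp_induct)
  case (step y z)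
  have *: "linked N H a b" if "a \<in> nonneg_vecs N" "b \<in> nonneg_vecs N" "a - b \<in> G" for a b
    using linked_shift[OF H[OF that(3)] move_decompose(1)[OF that(1,2)]]
      move_decompose(2,3)[OF that(1,2)] by simp
  from step.hyps(2) have "linked N H y z"
    using * linked_sym unfolding move_def by blast
  with step.IH show ?case by simp
qed simp

lemma vec_sum_carrier: "set vs \<subseteq> carrier_vec N \<Longrightarrow> vec_sum N vs \<in> carrier_vec N"
  by (induction vs) (auto simp: vec_sum_def)

lemma walk_imp_linked:
  assumes "S \<subseteq> carrier_vec N" "u \<in> nonneg_vecs N"
  shows "w \<in> nonneg_vecs N \<Longrightarrow> (\<forall>v \<in> set vs. v \<in> S \<or> - v \<in> S) \<Longrightarrow> w - u = vec_sum N vs \<Longrightarrow>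
    (\<forall>p \<in> {1..length vs}. w - vec_sum N (take p vs) \<in> nonneg_vecs N) \<Longrightarrow> linked N S w u"
proof (induction vs arbitrary: w)
  case Nil
  have "w = u"
  proof (rule eq_vecI)
    fix i assume i: "i < dim_vec u"
    have "(w - u) $ i = 0" using Nil i assms(2) by (simp add: vec_sum_def nonneg_vecs_iff)
    thus "w $ i = u $ i" using i by simp
  qed (use Nil assms(2) in \<open>auto simp: nonneg_vecs_iff\<close>)
  thus ?case by simp
next
  case (Cons v vs)
  have car: "set (v # vs) \<subseteq> carrier_vec N"
  proof
    fix x assume "x \<in> set (v # vs)"
    hence "x \<in> carrier_vec N \<or> - x \<in> carrier_vec N" using Cons.prems(2) assms(1) by blast
    thus "x \<in> carrier_vec N" using carrier_dim_vec index_uminus_vec(2) by metis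
  qed
  hence d: "dim_vec v = N" "dim_vec (vec_sum N vs) = N" using vec_sum_carrier[of vs N] by auto
  have dw: "dim_vec w = N" "dim_vec u = N"
    using Cons.prems(1) assms(2) by (auto simp: nonneg_vecs_iff)
  have "w - vec_sum N (take 1 (v # vs)) = w - v" using d dw by (intro eq_vecI) (auto simp: vec_sum_def)
  hence nn: "w - v \<in> nonneg_vecs N" using Cons.prems(4) by (auto dest!: bspec[of _ _ 1])
  have "w - v - u = vec_sum N vs"
  proof (rule eq_vecI)
    fix i assume i: "i < dim_vec (vec_sum N vs)"
    have "(w - u) $ i = v $ i + vec_sum N vs $ i"
      using Cons.prems(3) i d by (simp add: vec_sum_def)
    thus "(w - v - u) $ i = vec_sum N vs $ i" using i d dw by simp
  qed (use d dw in auto)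
  moreover have "\<forall>p \<in> {1..length vs}. w - v - vec_sum N (take p vs) \<in> nonneg_vecs N"
  proof
    fix p assume p: "p \<in> {1..length vs}"
    have "vec_sum N (take p vs) \<in> carrier_vec N"
      using car set_take_subset[of p vs] by (intro vec_sum_carrier) auto
    hence "w - v - vec_sum N (take p vs) = w - vec_sum N (take (Suc p) (v # vs))"
      using d dw by (intro eq_vecI) (auto simp: vec_sum_def)
    moreover have "Suc p \<in> {1..length (v # vs)}" using p by simp
    ultimately show "w - v - vec_sum N (take p vs) \<in> nonneg_vecs N" using Cons.prems(4) by metis
  qed
  ultimately have "linked N S (w - v) u" using Cons nn by auto
  moreover have "w - (w - v) = v" "(w - v) - w = - v" using d dw by (auto intro!: eq_vecI)
  hence "move N S w (w - v)" using Cons.prems(1,2) nn by (auto simp: move_def)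
  ultimately show ?case by (rule converse_rtranclp_into_rtranclp[rotated])
qed

lemma linked_imp_walk:
  assumes "linked N S w u" "u \<in> nonneg_vecs N"
  shows "\<exists>vs. (\<forall>v \<in> set vs. v \<in> S \<or> - v \<in> S) \<and> w - u = vec_sum N vs \<and>
    (\<forall>p \<in> {1..length vs}. w - vec_sum N (take p vs) \<in> nonneg_vecs N)"
  using assms(1)
proof (induction rule: converse_rtranclp_induct)
  case base
  have "u - u = vec_sum N []" using assms(2) by (auto simp: vec_sum_def nonneg_vecs_def)
  thus ?case by (intro exI[of _ "[]"]) auto
next
  case (step w w')
  then obtain vs where vs: "\<forall>v \<in> set vs. v \<in> S \<or> - v \<in> S" "w' - u = vec_sum N vs"
    "\<forall>p \<in> {1..length vs}. w' - vec_sum N (take p vs) \<in> nonneg_vecs N" by blast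
  have d: "dim_vec w = N" "dim_vec w' = N" "dim_vec u = N"
    using step.hyps(1) assms(2) by (auto simp: move_def nonneg_vecs_iff)
  have neg: "- (w - w') = w' - w" using d by (intro eq_vecI) auto
  have dsum: "dim_vec (vec_sum N (take p vs)) = N" if "p \<in> {1..length vs}" for p
  proof -
    have "dim_vec (w' - vec_sum N (take p vs)) = N"
      using vs(3) that by (auto simp: nonneg_vecs_iff)
    thus ?thesis by simp
  qed
  have rest: "w - vec_sum N (take p ((w - w') # vs)) \<in> nonneg_vecs N"
    if "p \<in> {1..length ((w - w') # vs)}" for p
  proof (cases "p = 1")
    case True
    have "w - vec_sum N (take p ((w - w') # vs)) = w'"
      unfolding True using d by (intro eq_vecI) (auto simp: vec_sum_def)
    thus ?thesis using step.hyps(1) by (simp add: move_def)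
  next
    case False
    define q where "q = p - 1"
    have q: "p = Suc q" "q \<in> {1..length vs}" using that False by (auto simp: q_def)
    have "w - vec_sum N (take p ((w - w') # vs)) = w' - vec_sum N (take q vs)"
      using d dsum[OF q(2)] by (intro eq_vecI) (auto simp: vec_sum_def q(1))
    thus ?thesis using vs(3) q(2) by simp
  qed
  have "w - u = (w - w') + (w' - u)" using d by (intro eq_vecI) auto
  hence "w - u = vec_sum N ((w - w') # vs)" unfolding vs(2) by (simp add: vec_sum_def)
  moreover have "\<forall>v \<in> set ((w - w') # vs). v \<in> S \<or> - v \<in> S"
    using vs(1) step.hyps(1) by (auto simp: move_def neg)
  ultimately show ?case using rest by blast
qed

text \<open>
  Walks are lists in the definition of a Markov basis and reflexive transitive closures below.
  Besides this change of language, the fibre condition is only required for the pairs of parts of kernel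
  elements, since shifts of these give all other pairs.
\<close>
lemma markov_basis_iff_linked:
  "markov_basis M S \<longleftrightarrow> finite S \<and> S \<subseteq> mat_kernel M \<and>
     (\<forall>g \<in> mat_kernel M. linked (dim_col M) S (pos_part g) (pos_part (- g)))"
    (is "?L \<longleftrightarrow> ?R")
proof
  let ?N = "dim_col M"
  have car: "mat_kernel M \<subseteq> carrier_vec ?N" by (auto simp: mat_kernel_def)
  { assume L: ?L
    have "linked ?N S (pos_part g) (pos_part (- g))" if g: "g \<in> mat_kernel M" for g
    proof -
      have gc: "g \<in> carrier_vec ?N" using g car by auto
      have nn: "pos_part g \<in> nonneg_vecs ?N" "pos_part (- g) \<in> nonneg_vecs ?N"
        using gc by (auto intro: pos_part_nonneg)
      obtain vs where vs: "\<forall>v\<in>set vs. v \<in> S \<or> - v \<in> S"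
        "pos_part g - pos_part (- g) = vec_sum ?N vs"
        "\<forall>p\<in>{1..length vs}. pos_part g - vec_sum ?N (take p vs) \<in> nonneg_vecs ?N"
        using L nn pos_part_diff[OF gc] g unfolding markov_basis_def by metis
      have "S \<subseteq> carrier_vec ?N" using L car by (auto simp: markov_basis_def)
      from walk_imp_linked[OF this nn(2,1) vs] show ?thesis .
    qed
    thus ?R using L by (auto simp: markov_basis_def) }
  { assume R: ?R
    have "linked ?N S w u" if "w \<in> nonneg_vecs ?N" "u \<in> nonneg_vecs ?N" "w - u \<in> mat_kernel M" for w u
      by (rule linked_replace[OF linked_move[OF that]]) (use R in auto)
    thus ?L using R linked_imp_walk unfolding markov_basis_def by blast }
qed

section \<open>Dickson's lemma\<close>

lemma nat_sequence_mono_subsequence: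
  fixes f :: "nat \<Rightarrow> nat"
  shows "\<exists>\<phi> :: nat \<Rightarrow> nat. strict_mono \<phi> \<and> mono (f \<circ> \<phi>)"
proof -
  obtain \<phi> :: "nat \<Rightarrow> nat" where \<phi>: "strict_mono \<phi>" "monoseq (\<lambda>k. f (\<phi> k))"
    using seq_monosub[of f] by blast
  show ?thesis
  proof (cases "mono (\<lambda>k. f (\<phi> k))")
    case True
    thus ?thesis using \<phi> by (intro exI[of _ \<phi>]) (simp add: comp_def)
  next
    case False
    \<comment> \<open>A weakly decreasing sequence of naturals is constant from the place of its least value on.\<close>
    hence dec: "f (\<phi> k) \<ge> f (\<phi> l)" if "k \<le> l" for k l
      using \<phi>(2) that unfolding monoseq_def mono_def by blast
    obtain k where k: "\<And>l. f (\<phi> k) \<le> f (\<phi> l)"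
      using ex_has_least_nat[of "\<lambda>_. True" 0 "\<lambda>k. f (\<phi> k)"] by auto
    have "f (\<phi> (k + l)) = f (\<phi> k)" for l
      using k[of "k + l"] dec[of k "k + l"] by simp
    moreover have "strict_mono (\<lambda>l. \<phi> (k + l))"
      using \<phi>(1) by (simp add: strict_mono_def)
    ultimately show ?thesis by (intro exI[of _ "\<lambda>l. \<phi> (k + l)"]) (simp add: mono_def)
  qed
qed

text \<open>
  Thin out the subsequence once for each function: passing to a subsequence keeps monotonicity.
\<close>
lemma finite_family_mono_subsequence:
  fixes F :: "('a \<Rightarrow> nat) set" and x :: "nat \<Rightarrow> 'a"
  assumes "finite F"
  shows "\<exists>\<phi> :: nat \<Rightarrow> nat. strict_mono \<phi> \<and> (\<forall>f \<in> F. mono (\<lambda>k. f (x (\<phi> k))))"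
  using assms
proof (induction F)
  case empty
  show ?case by (intro exI[of _ id]) (simp add: strict_mono_def)
next
  case (insert f F)
  then obtain \<phi> :: "nat \<Rightarrow> nat" where \<phi>: "strict_mono \<phi>" "\<forall>g \<in> F. mono (\<lambda>k. g (x (\<phi> k)))" by blast
  obtain \<psi> :: "nat \<Rightarrow> nat" where \<psi>: "strict_mono \<psi>" "mono (\<lambda>k. f (x (\<phi> (\<psi> k))))"
    using nat_sequence_mono_subsequence[of "\<lambda>k. f (x (\<phi> k))"] by (auto simp: comp_def)
  have "mono (\<lambda>k. g (x (\<phi> (\<psi> k))))" if "g \<in> F" for g
    using \<phi>(2) that strict_mono_mono[OF \<psi>(1)] by (simp add: mono_def)
  thus ?case using \<phi>(1) \<psi>
    by (intro exI[of _ "\<lambda>k. \<phi> (\<psi> k)"]) (auto simp: strict_mono_def)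
qed

text \<open>
  The functions in \<open>F\<close> play the role of coordinates.  In this form the lemma applies to integer
  vectors, with the coordinates of both parts as \<open>F\<close>.
\<close>
lemma dickson:
  fixes F :: "('a \<Rightarrow> nat) set"
  assumes "finite F" "infinite X"
  shows "\<exists>x \<in> X. \<exists>y \<in> X. x \<noteq> y \<and> (\<forall>f \<in> F. f x \<le> f y)"
proof -
  obtain x :: "nat \<Rightarrow> 'a" where x: "inj x" "range x \<subseteq> X"
    using infinite_countable_subset[OF assms(2)] by blast
  obtain \<phi> :: "nat \<Rightarrow> nat" where \<phi>: "strict_mono \<phi>" "\<forall>f \<in> F. mono (\<lambda>k. f (x (\<phi> k)))"
    using finite_family_mono_subsequence[OF assms(1)] by blast
  have "x (\<phi> 0) \<noteq> x (\<phi> 1)"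
    using x(1) \<phi>(1) by (metis inj_eq strict_mono_eq zero_neq_one)
  moreover have "\<forall>f \<in> F. f (x (\<phi> 0)) \<le> f (x (\<phi> 1))"
    using \<phi>(2) by (simp add: mono_def)
  ultimately show ?thesis using x(2) by blast
qed

section \<open>Markov bases of a homogeneous lattice\<close>

lemma total_add: "dim_vec x = dim_vec y \<Longrightarrow> total (x + y) = total x + total y"
  by (simp add: total_def sum.distrib)

lemma total_diff: "dim_vec x = dim_vec y \<Longrightarrow> total (x - y) = total x - total y"
  by (simp add: total_def sum_subtractf)

lemma total_nonneg: "x \<in> nonneg_vecs N \<Longrightarrow> 0 \<le> total x"
  by (auto simp: total_def nonneg_vecs_iff intro!: sum_nonneg)

lemma total_nonneg_eq_0: "x \<in> nonneg_vecs N \<Longrightarrow> total x = 0 \<Longrightarrow> x = 0\<^sub>v N"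
  using sum_nonneg_eq_0_iff[of "{..<N}" "\<lambda>i. x $ i"]
  by (intro eq_vecI) (auto simp: total_def nonneg_vecs_iff)

lemma height_nonneg: "0 \<le> height g"
  by (auto simp: height_def total_def intro!: sum_nonneg)

text \<open>
  The componentwise order on the pairs of positive and negative parts.
\<close>
definition conformal :: "int vec \<Rightarrow> int vec \<Rightarrow> bool" where
  "conformal f g \<longleftrightarrow> dim_vec f = dim_vec g \<and>
     (\<forall>i < dim_vec g. max 0 (f $ i) \<le> max 0 (g $ i) \<and> max 0 (- f $ i) \<le> max 0 (- g $ i))"

lemma conformal_trans: "conformal f g \<Longrightarrow> conformal g h \<Longrightarrow> conformal f h"
  unfolding conformal_def by (metis order_trans)

lemma conformal_height_mono: "conformal f g \<Longrightarrow> height f \<le> height g"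
  by (auto simp: conformal_def height_def total_def intro!: sum_mono)

lemma conformal_height_eq:
  assumes "conformal f g" "height f = height g"
  shows "pos_part f = pos_part g"
proof (rule eq_vecI)
  fix i assume i: "i < dim_vec (pos_part g)"
  have "(\<Sum>i<dim_vec g. max 0 (f $ i)) = (\<Sum>i<dim_vec g. max 0 (g $ i))"
    using assms by (auto simp: conformal_def height_def total_def)
  from sum_mono_inv[OF this] i show "pos_part f $ i = pos_part g $ i"
    using assms(1) by (auto simp: conformal_def)
qed (use assms in \<open>auto simp: conformal_def\<close>)

text \<open>
  Homogeneity makes all fibres finite and grades them; in particular zero is the only nonnegative
  element.
\<close>
locale homogeneous_lattice =
  fixes N :: nat and L :: "int vec set"
  assumes carrier: "L \<subseteq> carrier_vec N"
    and zero_closed: "0\<^sub>v N \<in> L"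
    and diff_closed: "g \<in> L \<Longrightarrow> h \<in> L \<Longrightarrow> g - h \<in> L"
    and homogeneous: "g \<in> L \<Longrightarrow> total g = 0"
begin

lemma dim_lattice: "g \<in> L \<Longrightarrow> dim_vec g = N"
  using carrier by auto

lemma uminus_closed: "g \<in> L \<Longrightarrow> - g \<in> L"
  using diff_closed[OF zero_closed, of g] zero_minus_vec[of g N] carrier by auto

lemma pos_nonneg: "g \<in> L \<Longrightarrow> pos_part g \<in> nonneg_vecs N"
  using pos_part_nonneg carrier by blast

lemma neg_nonneg: "g \<in> L \<Longrightarrow> pos_part (- g) \<in> nonneg_vecs N"
  using pos_nonneg uminus_closed by blast

lemma linked_by_element: "g \<in> G \<Longrightarrow> g \<in> L \<Longrightarrow> linked N G (pos_part g) (pos_part (- g))"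
  using pos_nonneg neg_nonneg pos_part_diff[of g N] carrier by (intro linked_move) auto

lemma height_uminus: "g \<in> L \<Longrightarrow> height (- g) = height g"
  using total_diff[of "pos_part g" "pos_part (- g)"] pos_part_diff[of g N] carrier homogeneous[of g]
  by (auto simp: height_def)

lemma height_eq_0: 
  assumes "g \<in> L" "height g = 0"
  shows "g = 0\<^sub>v N"
proof -
  have "pos_part g = 0\<^sub>v N" "pos_part (- g) = 0\<^sub>v N"
    using total_nonneg_eq_0[OF pos_nonneg] total_nonneg_eq_0[OF neg_nonneg] assms height_uminus[of g]
    by (auto simp: height_def)
  thus ?thesis using pos_part_diff[of g N] carrier assms(1) by auto
qed

lemma conformal_antisym:
  assumes "f \<in> L" "g \<in> L" "conformal f g" "height f = height g"
  shows "f = g"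
proof -
  have "conformal (- f) (- g)"
    using assms(3) by (auto simp: conformal_def)
  hence "pos_part (- f) = pos_part (- g)"
    using assms height_uminus by (intro conformal_height_eq) auto
  thus ?thesis using pos_part_diff[of f N] pos_part_diff[of g N] conformal_height_eq[OF assms(3,4)]
    assms carrier by auto
qed

definition graver :: "int vec set" where
  "graver = {g \<in> L - {0\<^sub>v N}. \<forall>f \<in> L - {0\<^sub>v N}. conformal f g \<longrightarrow> f = g}"

lemma finite_graver: "finite graver"
proof (rule ccontr)
  assume inf: "infinite graver"
  define F where "F = (\<lambda>i (g :: int vec). nat (g $ i)) ` {..<N} \<union> (\<lambda>i g. nat (- g $ i)) ` {..<N}"
  obtain f g where fg: "f \<in> graver" "g \<in> graver" "f \<noteq> g" "\<forall>c \<in> F. c f \<le> c g"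
    using dickson[OF _ inf, of F] by (auto simp: F_def)
  have "max 0 (f $ i) \<le> max 0 (g $ i) \<and> max 0 (- f $ i) \<le> max 0 (- g $ i)" if "i < N" for i
  proof -
    have "nat (f $ i) \<le> nat (g $ i)" "nat (- f $ i) \<le> nat (- g $ i)"
      using fg(4) that unfolding F_def by auto
    thus ?thesis by linarith
  qed
  hence "conformal f g"
    using fg(1,2) dim_lattice[of f] dim_lattice[of g] by (simp add: conformal_def graver_def)
  thus False using fg by (auto simp: graver_def)
qed

text \<open>
  Heights strictly decrease along the conformal order, so an element of least height will do.
\<close>
lemma ex_graver_below:
  assumes "g \<in> L" "g \<noteq> 0\<^sub>v N"
  shows "\<exists>f \<in> graver. conformal f g"
proof -
  let ?P = "\<lambda>f. f \<in> L \<and> f \<noteq> 0\<^sub>v N \<and> conformal f g"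
  have "?P g" using assms by (simp add: conformal_def)
  then obtain f where f: "?P f" "\<And>h. ?P h \<Longrightarrow> nat (height f) \<le> nat (height h)"
    using ex_has_least_nat[of ?P g "\<lambda>h. nat (height h)"] by blast
  have "h = f" if h: "h \<in> L - {0\<^sub>v N}" "conformal h f" for h
  proof -
    have "height f \<le> height h"
      using f(1) f(2)[of h] h conformal_trans height_nonneg[of h] by (auto simp: nat_le_eq_zle) 
    hence "height h = height f" using conformal_height_mono[OF h(2)] by simp
    thus ?thesis using conformal_antisym h f(1) by blast
  qed
  thus ?thesis using f(1) by (auto simp: graver_def)
qed

text \<open>
  If \<open>f\<close> is conformally below \<open>g\<close>, both parts of \<open>g\<close> split additively into those of \<open>f\<close> and \<open>g - f\<close>:
  first apply \<open>f\<close> next to the positive part of \<open>g - f\<close>, then go on by induction with \<open>g - f\<close> next to the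
  negative part of \<open>f\<close>.
\<close>
lemma graver_links: "g \<in> L \<Longrightarrow> linked N graver (pos_part g) (pos_part (- g))"
proof (induction "nat (height g)" arbitrary: g rule: less_induct)
  case less
  show ?case
  proof (cases "g = 0\<^sub>v N")
    case True
    have "- (0\<^sub>v N :: int vec) = 0\<^sub>v N" by (intro eq_vecI) auto
    thus ?thesis using True by simp
  next
    case False
    then obtain f where f: "f \<in> graver" "conformal f g" using ex_graver_below less.prems by blast
    have fL: "f \<in> L" "f \<noteq> 0\<^sub>v N" using f(1) by (auto simp: graver_def)
    have d: "dim_vec f = N" "dim_vec g = N" using fL less.prems dim_lattice by auto
    have c: "max 0 (f $ i) \<le> max 0 (g $ i)" "max 0 (- f $ i) \<le> max 0 (- g $ i)" if "i < N" for i
      using f(2) that d by (auto simp: conformal_def)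
    have pos: "pos_part g = pos_part (g - f) + pos_part f"
    proof (rule eq_vecI)
      fix i assume "i < dim_vec (pos_part (g - f) + pos_part f)"
      thus "pos_part g $ i = (pos_part (g - f) + pos_part f) $ i" using c[of i] d by (simp add: max_def split: if_splits)
    qed (use d in auto)
    have neg: "pos_part (- g) = pos_part (- (g - f)) + pos_part (- f)"
    proof (rule eq_vecI)
      fix i assume "i < dim_vec (pos_part (- (g - f)) + pos_part (- f))"
      thus "pos_part (- g) $ i = (pos_part (- (g - f)) + pos_part (- f)) $ i" using c[of i] d by (simp add: max_def split: if_splits)
    qed (use d in auto)
    have L': "g - f \<in> L" using diff_closed less.prems fL by blast
    have "height g = height (g - f) + height f"
      unfolding height_def pos using d by (simp add: total_add)
    moreover have "0 < height f" using height_eq_0 fL height_nonneg[of f] by force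
    ultimately have "linked N graver (pos_part (g - f)) (pos_part (- (g - f)))"
      using height_nonneg[of "g - f"] L' by (intro less.hyps) auto
    hence 1: "linked N graver (pos_part (g - f) + pos_part (- f)) (pos_part (- g))"
      unfolding neg using neg_nonneg fL by (intro linked_shift) auto
    have "linked N graver (pos_part f) (pos_part (- f))"
      using f(1) fL by (intro linked_by_element)
    hence "linked N graver (pos_part f + pos_part (g - f)) (pos_part (- f) + pos_part (g - f))"
      using pos_nonneg L' by (intro linked_shift) auto
    moreover have "pos_part f + pos_part (g - f) = pos_part g"
      "pos_part (- f) + pos_part (g - f) = pos_part (g - f) + pos_part (- f)"
      unfolding pos using d by (auto intro!: eq_vecI)
    ultimately show ?thesis using 1 by simp
  qed
qed

definition markov :: "int vec set \<Rightarrow> bool" where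
  "markov S \<longleftrightarrow> finite S \<and> S \<subseteq> L \<and> (\<forall>g \<in> L. linked N S (pos_part g) (pos_part (- g)))"

lemma markov_superset: "markov S \<Longrightarrow> S \<subseteq> T \<Longrightarrow> finite T \<Longrightarrow> T \<subseteq> L \<Longrightarrow> markov T"
  unfolding markov_def using linked_mono by metis

lemma markov_graver: "markov graver"
  using finite_graver graver_links by (auto simp: markov_def graver_def)

lemma markov_replace:
  assumes "markov S" "T \<subseteq> L" "finite T"
    and "\<And>g. g \<in> S \<Longrightarrow> linked N T (pos_part g) (pos_part (- g))"
  shows "markov T"
  using assms linked_replace[where G = S and H = T and N = N] unfolding markov_def by blast

lemma move_total:
  assumes "move N G x y" "G \<subseteq> L"
  shows "total y = total x"
proof -
  have "total (x - y) = 0 \<or> total (y - x) = 0" using assms homogeneous by (auto simp: move_def)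
  thus ?thesis using assms(1) by (auto simp: move_def nonneg_vecs_iff total_diff)
qed

lemma linked_total: "linked N G x y \<Longrightarrow> G \<subseteq> L \<Longrightarrow> total y = total x"
  by (induction rule: rtranclp_induct) (auto dest: move_total)

lemma height_le_total:
  assumes "x \<in> nonneg_vecs N" "y \<in> nonneg_vecs N"
  shows "height (x - y) \<le> total x"
  unfolding height_def using move_decompose(1,2)[OF assms] total_nonneg
  by (metis le_add_same_cancel1 total_add dim_vec_first nonneg_vecs_iff dim_pos_part index_minus_vec(2))

text \<open>
  A move \<open>g\<close> applied to \<open>y\<close> needs \<open>y\<close> to dominate the positive part of \<open>g\<close>, and all vectors on a
  walk have the same coordinate sum.
\<close>
lemma linked_bounded:
  assumes "linked N G x y" "G \<subseteq> L"
  shows "linked N {g \<in> G. height g \<le> total x} x y"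
  using assms(1)
proof (induction rule: rtranclp_induct)
  case (step y z)
  have t: "total y = total x" "total z = total x"
    using step.hyps linked_total[OF _ assms(2)] move_total[OF _ assms(2)] by auto
  have "height (y - z) \<le> total x" "height (z - y) \<le> total x"
    using height_le_total step.hyps(2) t unfolding move_def by metis+
  hence "move N {g \<in> G. height g \<le> total x} y z"
    using step.hyps(2) by (auto simp: move_def)
  with step.IH show ?case by (rule rtranclp.rtrancl_into_rtrancl)
qed simp

definition lower :: "int \<Rightarrow> int vec set" where
  "lower h = {g \<in> L. height g < h}"

definition indecomposable :: "int vec set" where
  "indecomposable = {v \<in> L. \<not> linked N (lower (height v)) (pos_part v) (pos_part (- v))}"

definition minimal_markov :: "int vec set \<Rightarrow> bool" where
  "minimal_markov S \<longleftrightarrow> markov S \<and> (\<forall>T. T \<subset> S \<longrightarrow> \<not> markov T)"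

lemma lower_linked_avoiding:
  assumes "markov S" "g \<in> lower h" 
  shows "linked N {s \<in> S. height s < h} (pos_part g) (pos_part (- g))"
proof -
  have "linked N S (pos_part g) (pos_part (- g))" "height g < h" "S \<subseteq> L"
    using assms by (auto simp: markov_def lower_def)
  from linked_bounded[OF this(1,3)] this(2) show ?thesis
    by (elim linked_mono) (auto simp: height_def)
qed

text \<open>
  A walk by lower moves can be rewritten with elements of the basis of lower height, so it never
  uses \<open>v\<close> or its negative and makes \<open>v\<close> redundant.
\<close>
lemma minimal_markov_indecomposable:
  assumes "minimal_markov S"
  shows "S \<subseteq> indecomposable"
proof
  fix v assume v: "v \<in> S"
  have M: "markov S" "S \<subseteq> L" "finite S" using assms by (auto simp: minimal_markov_def markov_def)
  show "v \<in> indecomposable"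
  proof (rule ccontr)
    assume "v \<notin> indecomposable"
    hence low: "linked N (lower (height v)) (pos_part v) (pos_part (- v))"
      using v M by (auto simp: indecomposable_def)
    have "linked N (S - {v}) (pos_part v) (pos_part (- v))"
    proof (rule linked_replace[OF low])
      fix g assume "g \<in> lower (height v)"
      from lower_linked_avoiding[OF M(1) this]
      show "linked N (S - {v}) (pos_part g) (pos_part (- g))" by (rule linked_mono) auto
    qed
    moreover have "linked N (S - {v}) (pos_part s) (pos_part (- s))" if "s \<in> S - {v}" for s
      using that M(2) by (intro linked_by_element) auto
    ultimately have "markov (S - {v})"
      using M by (intro markov_replace[OF M(1)]) auto
    thus False using assms v unfolding minimal_markov_def by blast
  qed
qed

text \<open>
  Adding the elements of \<open>Q\<close> to \<open>G\<close> one at a time, \<open>u\<close> is the one that first joins \<open>x\<close> to \<open>y\<close>.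
\<close>
lemma critical_move:
  assumes "finite Q" "linked N (Q \<union> G) x y" "\<not> linked N G x y"
  shows "\<exists>u \<in> Q. \<exists>P \<subseteq> Q - {u}. linked N (insert u (P \<union> G)) x y \<and> \<not> linked N (P \<union> G) x y"
  using assms
proof (induction Q)
  case (insert u Q)
  show ?case
  proof (cases "linked N (Q \<union> G) x y")
    case True
    from insert.IH[OF True insert.prems(2)] show ?thesis by blast
  next
    case False
    thus ?thesis using insert.prems(1) insert.hyps(2)
      by (intro bexI[of _ u] exI[of _ Q] conjI) auto
  qed
qed simp

text \<open>
  Nothing is left over for a spectator when the coordinate sum of \<open>x\<close> is used up by the move.
\<close>
lemma move_at_height:
  assumes "x \<in> nonneg_vecs N" "y \<in> nonneg_vecs N" "total x \<le> height (x - y)"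
  shows "x = pos_part (x - y)" "y = pos_part (- (x - y))"
proof -
  note D = move_decompose[OF assms(1,2)]
  let ?e = "x - pos_part (x - y)"
  have "total x = total (pos_part (x - y)) + total ?e"
    using D(2) assms(1,2) by (metis total_add dim_pos_part index_minus_vec(2) nonneg_vecs_iff)
  hence "total ?e = 0" using assms(3) total_nonneg[OF D(1)] by (simp add: height_def)
  hence e: "?e = 0\<^sub>v N" using total_nonneg_eq_0 D(1) by blast
  have "dim_vec x = N" "dim_vec y = N" using assms by (auto simp: nonneg_vecs_iff)
  thus "x = pos_part (x - y)" "y = pos_part (- (x - y))"
    using D(2,3) unfolding e by (metis right_zero_vec carrier_vecI dim_pos_part index_minus_vec(2) index_uminus_vec(2))+
qed

text \<open>
  By \<open>move_at_height\<close>, in a fibre of degree at most \<open>height u\<close> the move \<open>u\<close> is a single edge, between its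
  own two parts; a walk that needs it can be cut down to crossing it once.
\<close>
lemma linked_through_top_move:
  assumes "linked N (insert u G) x y" "u \<in> L" "G \<subseteq> L" "total x \<le> height u"
  shows "linked N G x y \<or>
    (linked N G x (pos_part u) \<and> linked N G (pos_part (- u)) y) \<or>
    (linked N G x (pos_part (- u)) \<and> linked N G (pos_part u) y)"
  using assms(1)
proof (induction rule: rtranclp_induct)
  case (step y z)
  have nn: "y \<in> nonneg_vecs N" "z \<in> nonneg_vecs N" using step.hyps(2) by (auto simp: move_def)
  have t: "total y = total x" "total z = total x"
    using step.hyps linked_total[of "insert u G"] move_total[of "insert u G"] assms(2,3) by auto
  consider "move N G y z" | "y - z = u" | "z - y = u" using step.hyps(2) by (auto simp: move_def)
  thus ?case
  proof cases
    case 1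
    thus ?thesis using step.IH by (meson rtranclp.rtrancl_into_rtrancl)
  next
    case 2
    hence "y = pos_part u" "z = pos_part (- u)" using move_at_height[OF nn] t assms(4) by auto
    thus ?thesis using step.IH by auto
  next
    case 3
    hence "z = pos_part u" "y = pos_part (- u)" using move_at_height[OF nn(2,1)] t assms(4) by auto
    thus ?thesis using step.IH by auto
  qed
qed simp

text \<open>
  As in the exchange property of spanning trees: a walk from one part of \<open>v\<close> to the other crosses
  some edge \<open>u\<close> that it cannot do without.  Its two ends reach the ends of \<open>v\<close> without \<open>u\<close>, so \<open>v\<close> closes the
  gap that the removal of \<open>u\<close> leaves.
\<close>
lemma exchange:
  assumes v: "v \<in> indecomposable" and T: "markov T" and P: "markov (T - {v})"
  shows "\<exists>u \<in> T - {v}. markov (insert v (T - {u}))"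
proof -
  let ?h = "height v" and ?low = "lower (height v)" and ?v1 = "pos_part v" and ?v2 = "pos_part (- v)"
  have vL: "v \<in> L" and nlow: "\<not> linked N ?low ?v1 ?v2" using v by (auto simp: indecomposable_def)
  have "linked N ((T - {v}) \<union> ?low) ?v1 ?v2"
    using P vL by (auto simp: markov_def elim: linked_mono)
  then obtain u Q where u: "u \<in> T - {v}" and Q: "Q \<subseteq> T - {v} - {u}"
    "linked N (insert u (Q \<union> ?low)) ?v1 ?v2" "\<not> linked N (Q \<union> ?low) ?v1 ?v2"
    using critical_move[OF _ _ nlow, of "T - {v}"] P unfolding markov_def by blast
  have uL: "u \<in> L" and TL: "T \<subseteq> L" and fin: "finite T" using u T by (auto simp: markov_def)
  \<comment> \<open>A lower move would already be available, so adding it could not join anything new.\<close>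
  have hu: "?h \<le> height u"
  proof (rule ccontr)
    assume "\<not> ?h \<le> height u"
    hence "insert u (Q \<union> ?low) = Q \<union> ?low" using uL by (auto simp: lower_def)
    thus False using Q by simp
  qed
  let ?T = "insert v (T - {u})"
  have sub: "linked N ?T x y" if "linked N (Q \<union> ?low) x y" for x y
    using that
  proof (rule linked_replace)
    fix g assume "g \<in> Q \<union> ?low"
    thus "linked N ?T (pos_part g) (pos_part (- g))"
    proof
      assume "g \<in> Q"
      thus ?thesis using Q(1) TL by (intro linked_by_element) auto
    next
      assume "g \<in> ?low"
      from lower_linked_avoiding[OF T this] show ?thesis
        by (rule linked_mono) (use hu in auto)
    qed
  qed
  have vv: "linked N ?T ?v1 ?v2"
    using vL by (intro linked_by_element) auto
  have "Q \<union> ?low \<subseteq> L" using Q(1) TL by (auto simp: lower_def)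
  from linked_through_top_move[OF Q(2) uL this] hu Q(3)
  consider "linked N ?T ?v1 (pos_part u)" "linked N ?T (pos_part (- u)) ?v2"
    | "linked N ?T ?v1 (pos_part (- u))" "linked N ?T (pos_part u) ?v2"
    using sub by (auto simp: height_def)
  hence uu: "linked N ?T (pos_part u) (pos_part (- u))"
    by cases (meson vv linked_sym rtranclp_trans)+
  have "markov ?T"
  proof (rule markov_replace[OF T])
    fix g assume g: "g \<in> T"
    show "linked N ?T (pos_part g) (pos_part (- g))"
    proof (cases "g = u")
      case False
      thus ?thesis using g TL by (intro linked_by_element) auto
    qed (use uu in simp)
  qed (use TL vL fin in auto)
  thus ?thesis using u by blast
qed

lemma indecomposable_in_minimal_markov:
  assumes v: "v \<in> indecomposable"
  shows "\<exists>S. minimal_markov S \<and> v \<in> S"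
proof -
  let ?P = "\<lambda>T. markov T \<and> v \<in> T"
  have vL: "v \<in> L" using v by (simp add: indecomposable_def)
  have "?P (insert v graver)"
    using vL finite_graver by (auto intro!: markov_superset[OF markov_graver] simp: graver_def)
  then obtain T where T: "?P T" and least: "\<And>S. ?P S \<Longrightarrow> card T \<le> card S"
    using ex_has_least_nat[of ?P _ card] by metis
  have fin: "finite T" using T by (simp add: markov_def)
  have no_smaller: "\<not> ?P S" if "S \<subset> T" for S
    using least[of S] psubset_card_mono[OF fin that] by linarith
  have "\<not> markov S" if S: "S \<subset> T" for S
  proof
    assume M: "markov S"
    hence "v \<notin> S" using no_smaller[OF S] by blast
    hence "markov (T - {v})" using S fin T by (intro markov_superset[OF M]) (auto simp: markov_def)
    then obtain u where u: "u \<in> T - {v}" "markov (insert v (T - {u}))"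
      using exchange[OF v] T by blast
    moreover have "insert v (T - {u}) \<subset> T" using u(1) T by blast
    ultimately show False using no_smaller by blast
  qed
  thus ?thesis using T by (auto simp: minimal_markov_def)
qed

theorem Union_minimal_markov: "\<Union> {S. minimal_markov S} = indecomposable"
  using minimal_markov_indecomposable indecomposable_in_minimal_markov by blast

end

lemma universal_markov_basis_lattice:
  assumes "homogeneous_lattice (dim_col M) (mat_kernel M)"
  shows "universal_markov_basis M =
    up_to_sign (homogeneous_lattice.indecomposable (dim_col M) (mat_kernel M))"
proof -
  interpret homogeneous_lattice "dim_col M" "mat_kernel M" by (fact assms)
  have "markov_basis M = markov"
    by (intro ext) (simp add: markov_basis_iff_linked markov_def)
  hence "minimal_markov_basis M = minimal_markov"
    by (intro ext) (simp add: minimal_markov_basis_def minimal_markov_def)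
  thus ?thesis using Union_minimal_markov by (simp add: universal_markov_basis_def)
qed

section \<open>The kernel of a Lawrence lifting\<close>

lemma block_index_less: "i < r \<Longrightarrow> j < n \<Longrightarrow> i * n + j < r * (n :: nat)"
  by (metis div_less_iff_less_mult div_mult_self3 div_less add_0_right less_nat_zero_code mult_0_right not_gr_zero)

lemma sum_blocks:
  fixes f :: "nat \<Rightarrow> 'a::comm_monoid_add"
  shows "(\<Sum>k<r * n. f k) = (\<Sum>i<r. \<Sum>j<n. f (i * n + j))"
proof -
  have "sum f {i * n..<i * n + n} = (\<Sum>j<n. f (i * n + j))" for i
    using sum.shift_bounds_nat_ivl[of f 0 "i * n" n] by (simp add: add.commute atLeast0LessThan)
  thus ?thesis by (simp flip: sum.nat_group)
qed

lemma vec_eq_blocksI: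
  assumes "dim_vec v = r * n" "dim_vec w = r * n"
    and "\<And>i j. i < r \<Longrightarrow> j < n \<Longrightarrow> v $ (i * n + j) = w $ (i * n + j)"
  shows "v = w"
proof (rule eq_vecI)
  fix k assume "k < dim_vec w"
  hence k: "k < r * n" using assms(2) by simp
  hence "k div n < r" "k mod n < n"
    by (cases n; simp add: less_mult_imp_div_less)+
  from assms(3)[OF this] show "v $ k = w $ k" by simp
qed (use assms in simp)

lemma diag_block_mat_replicate_mult_vec_eq_0:
  fixes A :: "'a::comm_ring_1 mat"
  assumes A: "A \<in> carrier_mat m n"
  shows "v \<in> carrier_vec (r * n) \<Longrightarrow>
    diag_block_mat (replicate r A) *\<^sub>v v = 0\<^sub>v (r * m) \<longleftrightarrow>
    (\<forall>i<r. A *\<^sub>v vec n (\<lambda>j. v $ (i * n + j)) = 0\<^sub>v m)"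
proof (induction r arbitrary: v)
  case 0
  thus ?case by (auto intro!: eq_vecI)
next
  case (Suc r)
  let ?D = "diag_block_mat (replicate r A)"
  have D: "?D \<in> carrier_mat (r * m) (r * n)"
    using A by (intro carrier_matI) (auto simp: dim_diag_block_mat sum_list_replicate)
  define a d where "a = vec n (\<lambda>j. v $ j)" and "d = vec (r * n) (\<lambda>k. v $ (n + k))"
  have ad: "a \<in> carrier_vec n" "d \<in> carrier_vec (r * n)" by (auto simp: a_def d_def)
  have v: "v = a @\<^sub>v d"
    using Suc.prems by (intro eq_vecI) (auto simp: a_def d_def)
  have zero: "0\<^sub>m p q *\<^sub>v x = 0\<^sub>v p" if "x \<in> carrier_vec q" for p q and x :: "'a vec"
    using that by (intro eq_vecI) (auto simp: scalar_prod_def)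
  have "diag_block_mat (replicate (Suc r) A) *\<^sub>v v = (A *\<^sub>v a) @\<^sub>v (?D *\<^sub>v d)"
    unfolding v using A D ad
    by (simp add: Let_def four_block_mat_mult_vec[OF A _ _ D ad] zero)
  moreover have "(0\<^sub>v (Suc r * m) :: 'a vec) = 0\<^sub>v m @\<^sub>v 0\<^sub>v (r * m)"
    by (intro eq_vecI) auto
  ultimately have "diag_block_mat (replicate (Suc r) A) *\<^sub>v v = 0\<^sub>v (Suc r * m) \<longleftrightarrow>
      A *\<^sub>v a = 0\<^sub>v m \<and> ?D *\<^sub>v d = 0\<^sub>v (r * m)"
    by (simp add: append_vec_eq[OF mult_mat_vec_carrier[OF A ad(1)] zero_carrier_vec])
  moreover have "vec n (\<lambda>j. d $ (i * n + j)) = vec n (\<lambda>j. v $ (Suc i * n + j))" if "i < r" for i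
  proof (rule eq_vecI)
    fix j assume "j < dim_vec (vec n (\<lambda>j. v $ (Suc i * n + j)))"
    thus "vec n (\<lambda>j. d $ (i * n + j)) $ j = vec n (\<lambda>j. v $ (Suc i * n + j)) $ j"
      using block_index_less[OF that, of j n] by (simp add: d_def add.assoc)
  qed simp
  ultimately show ?case using Suc.IH[OF ad(2)] by (simp add: All_less_Suc2 a_def)
qed

text \<open>
  The kernel of a Lawrence lifting in block coordinates.  The matrix enters as a function of its
  indices so that \<open>A\<close> and its submatrix \<open>B\<close> are described by the same coefficients.
\<close>
definition lawrence_moves :: "(nat \<Rightarrow> nat \<Rightarrow> int) \<Rightarrow> nat \<Rightarrow> nat \<Rightarrow> nat \<Rightarrow> int vec set" where
  "lawrence_moves a m r n = {v \<in> carrier_vec (r * n).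
     (\<forall>i<r. \<forall>k<m. (\<Sum>j<n. a k j * v $ (i * n + j)) = 0) \<and>
     (\<forall>j<n. (\<Sum>i<r. v $ (i * n + j)) = 0)}"

lemma dim_col_lawrence_lifting: "dim_col (lawrence_lifting r A) = r * dim_col A"
  by (simp add: lawrence_lifting_def Let_def append_rows_def dim_diag_block_mat sum_list_replicate)

lemma kernel_lawrence_lifting:
  "mat_kernel (lawrence_lifting r A) =
     lawrence_moves (\<lambda>k j. A $$ (k, j)) (dim_row A) r (dim_col A)"
proof -
  let ?m = "dim_row A" and ?n = "dim_col A"
  define D where "D = diag_block_mat (replicate r A)"
  define J :: "int mat" where "J = mat ?n (r * ?n) (\<lambda>(i, j). if j mod ?n = i then 1 else 0)"
  have D: "D \<in> carrier_mat (r * ?m) (r * ?n)"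
    unfolding D_def by (intro carrier_matI) (auto simp: dim_diag_block_mat sum_list_replicate)
  have J: "J \<in> carrier_mat ?n (r * ?n)" by (simp add: J_def)
  have lift: "lawrence_lifting r A = D @\<^sub>r J" by (simp add: lawrence_lifting_def Let_def D_def J_def)
  have "lawrence_lifting r A \<in> carrier_mat (r * ?m + ?n) (r * ?n)" using D J by (simp add: lift)
  note ker = mat_kernel[OF this]
  have "lawrence_lifting r A *\<^sub>v v = 0\<^sub>v (r * ?m + ?n) \<longleftrightarrow>
      (\<forall>i<r. \<forall>k<?m. (\<Sum>j<?n. A $$ (k, j) * v $ (i * ?n + j)) = 0) \<and>
      (\<forall>j<?n. (\<Sum>i<r. v $ (i * ?n + j)) = 0)" (is "_ \<longleftrightarrow> ?rows \<and> ?cols")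
    if v: "v \<in> carrier_vec (r * ?n)" for v
  proof -
    have "(0\<^sub>v (r * ?m + ?n) :: int vec) = 0\<^sub>v (r * ?m) @\<^sub>v 0\<^sub>v ?n" by (intro eq_vecI) auto
    hence "lawrence_lifting r A *\<^sub>v v = 0\<^sub>v (r * ?m + ?n) \<longleftrightarrow>
        D *\<^sub>v v = 0\<^sub>v (r * ?m) \<and> J *\<^sub>v v = 0\<^sub>v ?n"
      unfolding lift mat_mult_append[OF D J v] 
      by (simp add: append_vec_eq[OF mult_mat_vec_carrier[OF D v] zero_carrier_vec])
    moreover have "D *\<^sub>v v = 0\<^sub>v (r * ?m) \<longleftrightarrow> ?rows"
      unfolding D_def diag_block_mat_replicate_mult_vec_eq_0[OF carrier_matI[OF refl refl] v]
      by (simp add: vec_eq_iff scalar_prod_def atLeast0LessThan)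
    moreover have "(J *\<^sub>v v) $ j = (\<Sum>i<r. v $ (i * ?n + j))" if "j < ?n" for j
    proof -
      have "(J *\<^sub>v v) $ j = (\<Sum>k<r * ?n. (if k mod ?n = j then 1 else 0) * v $ k)"
        using that v by (simp add: J_def scalar_prod_def atLeast0LessThan)
      also have "\<dots> = (\<Sum>i<r. \<Sum>l<?n. (if l = j then v $ (i * ?n + l) else 0))"
        unfolding sum_blocks by (intro sum.cong) auto
      finally show ?thesis using that by simp
    qed
    hence "J *\<^sub>v v = 0\<^sub>v ?n \<longleftrightarrow> ?cols" using J by (simp add: vec_eq_iff)
    ultimately show ?thesis by blast
  qed
  thus ?thesis unfolding ker lawrence_moves_def by blast
qed

lemma homogeneous_lattice_lawrence_moves:
  "homogeneous_lattice (r * n) (lawrence_moves a m r n)"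
proof
  fix g h assume g: "g \<in> lawrence_moves a m r n" and h: "h \<in> lawrence_moves a m r n"
  have d: "dim_vec g = r * n" "dim_vec h = r * n" using g h by (auto simp: lawrence_moves_def)
  have i: "(g - h) $ (i * n + j) = g $ (i * n + j) - h $ (i * n + j)" if "i < r" "j < n" for i j
    using block_index_less[OF that] d by simp
  show "g - h \<in> lawrence_moves a m r n"
    using g h by (auto simp: lawrence_moves_def i right_diff_distrib sum_subtractf)
  have "total g = (\<Sum>j<n. \<Sum>i<r. g $ (i * n + j))"
    unfolding total_def d sum_blocks by (rule sum.swap)
  thus "total g = 0" using g by (simp add: lawrence_moves_def)
qed (auto simp: lawrence_moves_def block_index_less)

section \<open>Padding with zero columns\<close>

text \<open>
  The map \<open>\<sigma>\<close> on vectorised matrices: appending \<open>n - s\<close> zero columns changes the row length and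
  therefore the position of every entry.
\<close>
definition pad :: "nat \<Rightarrow> nat \<Rightarrow> nat \<Rightarrow> int vec \<Rightarrow> int vec" where
  "pad r s n v = vec (r * n) (\<lambda>k. if k mod n < s then v $ (k div n * s + k mod n) else 0)"

lemma dim_pad [simp]: "dim_vec (pad r s n v) = r * n"
  by (simp add: pad_def)

lemma index_pad:
  "i < r \<Longrightarrow> j < n \<Longrightarrow> pad r s n v $ (i * n + j) = (if j < s then v $ (i * s + j) else 0)"
  by (simp add: pad_def block_index_less)

locale lawrence_face =
  fixes a :: "nat \<Rightarrow> nat \<Rightarrow> int" and m r s n :: nat
  assumes s_le: "s \<le> n"
begin

sublocale big: homogeneous_lattice "r * n" "lawrence_moves a m r n"
  by (rule homogeneous_lattice_lawrence_moves)

sublocale small: homogeneous_lattice "r * s" "lawrence_moves a m r s"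
  by (rule homogeneous_lattice_lawrence_moves)

abbreviation embed :: "int vec \<Rightarrow> int vec" where "embed \<equiv> pad r s n"

lemma sum_padded:
  fixes f :: "nat \<Rightarrow> 'a::comm_monoid_add"
  shows "(\<Sum>j<n. if j < s then f j else 0) = (\<Sum>j<s. f j)"
  using s_le by (auto simp: sum.If_cases intro!: sum.cong)

lemma embed_diff:
  "dim_vec v = r * s \<Longrightarrow> dim_vec w = r * s \<Longrightarrow> embed (v - w) = embed v - embed w"
  by (rule vec_eq_blocksI[of _ r n]) (auto simp: index_pad block_index_less)

lemma embed_uminus: "dim_vec v = r * s \<Longrightarrow> embed (- v) = - embed v"
  by (rule vec_eq_blocksI[of _ r n]) (auto simp: index_pad block_index_less)

lemma embed_pos_part: "dim_vec v = r * s \<Longrightarrow> pos_part (embed v) = embed (pos_part v)"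
  by (rule vec_eq_blocksI[of _ r n]) (auto simp: index_pad block_index_less)

lemma embed_total:
  assumes "dim_vec v = r * s"
  shows "total (embed v) = total v"
proof -
  have "(\<Sum>j<n. embed v $ (i * n + j)) = (\<Sum>j<s. v $ (i * s + j))" if "i < r" for i
    using that by (subst sum_padded[symmetric]) (auto simp: index_pad intro!: sum.cong)
  thus ?thesis by (simp add: total_def assms sum_blocks)
qed

lemma embed_height: "dim_vec v = r * s \<Longrightarrow> height (embed v) = height v"
  by (simp add: height_def embed_pos_part embed_total)

lemma embed_inject:
  assumes "dim_vec v = r * s" "dim_vec w = r * s" "embed v = embed w"
  shows "v = w"
proof (rule vec_eq_blocksI[OF assms(1,2)])
  fix i j assume "i < r" "j < s"
  thus "v $ (i * s + j) = w $ (i * s + j)"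
    using arg_cong[OF assms(3), of "\<lambda>x. x $ (i * n + j)"] s_le by (simp add: index_pad)
qed

lemma embed_in_lattice_iff:
  assumes "dim_vec v = r * s"
  shows "embed v \<in> lawrence_moves a m r n \<longleftrightarrow> v \<in> lawrence_moves a m r s"
proof -
  have "(\<Sum>j<n. a k j * embed v $ (i * n + j)) = (\<Sum>j<s. a k j * v $ (i * s + j))" if "i < r" for i k
  proof -
    have "(\<Sum>j<n. a k j * embed v $ (i * n + j)) =
        (\<Sum>j<n. if j < s then a k j * v $ (i * s + j) else 0)"
      using that by (intro sum.cong) (auto simp: index_pad)
    thus ?thesis by (simp add: sum_padded)
  qed
  moreover have "(\<Sum>i<r. embed v $ (i * n + j)) = (if j < s then \<Sum>i<r. v $ (i * s + j) else 0)"
    if "j < n" for j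
    using that by (simp add: index_pad)
  moreover have "v \<in> carrier_vec (r * s)" using assms by (rule carrier_vecI)
  moreover have "embed v \<in> carrier_vec (r * n)" by (rule carrier_vecI) simp
  ultimately show ?thesis using s_le by (auto simp: lawrence_moves_def)
qed

lemma embed_nonneg: "x \<in> nonneg_vecs (r * s) \<Longrightarrow> embed x \<in> nonneg_vecs (r * n)"
proof -
  assume x: "x \<in> nonneg_vecs (r * s)"
  have "0 \<le> embed x $ k" if k: "k < r * n" for k
  proof -
    have "k div n < r" using k by (simp add: less_mult_imp_div_less)
    thus ?thesis using x k by (auto simp: pad_def nonneg_vecs_iff block_index_less)
  qed
  thus ?thesis by (simp add: nonneg_vecs_iff)
qed

text \<open>
  The last columns of \<open>y\<close> have the same sums as those of \<open>embed x\<close>, that is zero, and \<open>y\<close> is nonnegative.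
  So a walk that starts in the image of the embedding never leaves it.
\<close>
lemma face:
  assumes x: "x \<in> nonneg_vecs (r * s)" and y: "y \<in> nonneg_vecs (r * n)"
    and xy: "embed x - y \<in> lawrence_moves a m r n"
  shows "\<exists>y' \<in> nonneg_vecs (r * s). y = embed y'"
proof -
  have dy: "dim_vec y = r * n" using y by (simp add: nonneg_vecs_iff)
  have zero: "y $ (i * n + j) = 0" if i: "i < r" and j: "j < n" "\<not> j < s" for i j
  proof -
    have "(\<Sum>i<r. (embed x - y) $ (i * n + j)) = 0" using xy j by (simp add: lawrence_moves_def)
    hence "(\<Sum>i<r. y $ (i * n + j)) = 0"
      using j dy by (simp add: index_pad block_index_less sum_negf)
    moreover have "\<forall>i<r. 0 \<le> y $ (i * n + j)"
      using y j block_index_less by (simp add: nonneg_vecs_iff)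
    ultimately show ?thesis
      using sum_nonneg_eq_0_iff[of "{..<r}" "\<lambda>i. y $ (i * n + j)"] i by simp
  qed
  define y' where "y' = vec (r * s) (\<lambda>k. y $ (k div s * n + k mod s))"
  have "y = embed y'"
  proof (rule vec_eq_blocksI[OF dy])
    fix i j assume "i < r" "j < n"
    thus "y $ (i * n + j) = embed y' $ (i * n + j)"
      using zero[of i j] by (auto simp: index_pad y'_def block_index_less)
  qed simp
  moreover have "0 \<le> y' $ k" if k: "k < r * s" for k
  proof -
    have "k div s < r" "k mod s < s"
      using k by (cases s; simp add: less_mult_imp_div_less)+
    hence "k div s * n + k mod s < r * n" using s_le by (intro block_index_less) auto
    thus ?thesis using y k by (simp add: y'_def nonneg_vecs_iff)
  qed
  ultimately show ?thesis by (auto simp: nonneg_vecs_iff y'_def)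
qed

lemma move_embed_iff:
  assumes "x \<in> nonneg_vecs (r * s)" "y \<in> nonneg_vecs (r * s)"
  shows "move (r * n) (big.lower h) (embed x) (embed y) \<longleftrightarrow> move (r * s) (small.lower h) x y"
proof -
  have d: "dim_vec x = r * s" "dim_vec y = r * s" using assms by (auto simp: nonneg_vecs_iff)
  show ?thesis
    using assms embed_nonneg d
    by (simp add: move_def big.lower_def small.lower_def embed_in_lattice_iff embed_height
        flip: embed_diff)
qed

text \<open>
  A walk between vectors of the large lattice is pulled back step by step with \<open>face\<close>.
\<close>
lemma linked_embed_iff:
  assumes x: "x \<in> nonneg_vecs (r * s)" and y: "y \<in> nonneg_vecs (r * s)"
  shows "linked (r * n) (big.lower h) (embed x) (embed y) \<longleftrightarrow> linked (r * s) (small.lower h) x y"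
proof
  assume "linked (r * n) (big.lower h) (embed x) (embed y)"
  hence "\<exists>z \<in> nonneg_vecs (r * s). embed y = embed z \<and> linked (r * s) (small.lower h) x z"
  proof (induction rule: rtranclp_induct)
    case base
    show ?case using x by blast
  next
    case (step b c)
    then obtain b' where b': "b' \<in> nonneg_vecs (r * s)" "b = embed b'"
      "linked (r * s) (small.lower h) x b'" by blast
    have "c \<in> nonneg_vecs (r * n)" "b - c \<in> lawrence_moves a m r n"
    proof -
      show "c \<in> nonneg_vecs (r * n)" using step.hyps(2) by (simp add: move_def)
      have "dim_vec b = r * n" "dim_vec c = r * n"
        using step.hyps(2) by (auto simp: move_def nonneg_vecs_iff)
      hence "- (c - b) = b - c" by (intro eq_vecI) auto
      thus "b - c \<in> lawrence_moves a m r n"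
        using step.hyps(2) big.uminus_closed[of "c - b"] by (auto simp: move_def big.lower_def)
    qed
    then obtain c' where c': "c' \<in> nonneg_vecs (r * s)" "c = embed c'"
      using face[OF b'(1)] b'(2) by blast
    have "move (r * s) (small.lower h) b' c'"
      using step.hyps(2) move_embed_iff[OF b'(1) c'(1)] b'(2) c'(2) by simp
    from rtranclp.rtrancl_into_rtrancl[OF b'(3) this] show ?case using c' by blast
  qed
  thus "linked (r * s) (small.lower h) x y"
    using embed_inject y by (metis nonneg_vecs_iff)
next
  assume "linked (r * s) (small.lower h) x y"
  thus "linked (r * n) (big.lower h) (embed x) (embed y)"
  proof (induction rule: rtranclp_induct)
    case (step b c)
    hence "move (r * n) (big.lower h) (embed b) (embed c)"
      using move_embed_iff by (simp add: move_def)
    with step.IH show ?case by (rule rtranclp.rtrancl_into_rtrancl)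
  qed simp
qed

lemma embed_indecomposable_iff:
  assumes "v \<in> lawrence_moves a m r s"
  shows "embed v \<in> big.indecomposable \<longleftrightarrow> v \<in> small.indecomposable"
proof -
  have d: "dim_vec v = r * s" using small.dim_lattice assms .
  show ?thesis
    using assms d linked_embed_iff[OF small.pos_nonneg small.neg_nonneg, OF assms assms]
    by (simp add: big.indecomposable_def small.indecomposable_def embed_in_lattice_iff
        embed_height embed_pos_part flip: embed_uminus)
qed

end

section \<open>From vectors to matrices and sign classes\<close>

lemma block_rows_uminus: "dim_vec v = r * n \<Longrightarrow> block_rows r n (- v) = - block_rows r n v"
  by (rule eq_matI) (auto simp: block_rows_def block_index_less)

lemma block_rows_inject:
  assumes "dim_vec v = r * n" "dim_vec w = r * n" "block_rows r n v = block_rows r n w"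
  shows "v = w"
proof (rule vec_eq_blocksI[OF assms(1,2)])
  fix i j assume "i < r" "j < n"
  thus "v $ (i * n + j) = w $ (i * n + j)"
    using arg_cong[OF assms(3), of "\<lambda>M. M $$ (i, j)"] by (simp add: block_rows_def)
qed

lemma append_zero_cols_block_rows:
  "append_zero_cols n (block_rows r s v) = block_rows r n (pad r s n v)"
  by (rule eq_matI) (auto simp: append_zero_cols_def block_rows_def index_pad)

lemma lawrence_universal_markov_eq:
  fixes A :: "int mat" and r :: nat
  defines "L \<equiv> lawrence_moves (\<lambda>k j. A $$ (k, j)) (dim_row A) r (dim_col A)"
  shows "lawrence_universal_markov r A = up_to_sign
    (block_rows r (dim_col A) ` homogeneous_lattice.indecomposable (r * dim_col A) L)"
proof -
  interpret homogeneous_lattice "r * dim_col A" L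
    unfolding L_def by (rule homogeneous_lattice_lawrence_moves)
  have "universal_markov_basis (lawrence_lifting r A) = up_to_sign indecomposable"
    using universal_markov_basis_lattice[of "lawrence_lifting r A"] homogeneous_lattice_axioms
    by (simp add: kernel_lawrence_lifting dim_col_lawrence_lifting L_def)
  moreover have "block_rows r (dim_col A) (- v) = - block_rows r (dim_col A) v"
    if "v \<in> indecomposable" for v
    using that dim_lattice by (intro block_rows_uminus) (simp add: indecomposable_def)
  ultimately show ?thesis
    by (auto simp: lawrence_universal_markov_def up_to_sign_def image_image cong: image_cong)
qed

theorem theorem2p4:
  fixes m n s r :: nat and as :: "int vec list" and A B :: "int mat"
  assumes "length as = n"
    and "set as \<subseteq> nonneg_vecs m"
    and "A = mat_of_cols m as"
    and "mat_kernel A \<inter> nonneg_vecs n = {0\<^sub>v n}"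
    and "s \<le> n"
    and "B = mat_of_cols m (take s as)"
    and "r \<ge> 2"
  shows "(\<lambda>c. append_zero_cols n ` c) ` lawrence_universal_markov r B =
         lawrence_universal_markov r A \<inter>
           up_to_sign (append_zero_cols n ` lawrence_lattice r B)"
proof -
  define a where "a = (\<lambda>k j. A $$ (k, j))"
  interpret lawrence_face a m r s n by unfold_locales (fact assms(5))
  have dims: "dim_row A = m" "dim_col A = n" "dim_row B = m" "dim_col B = s"
    using assms by auto
  have AB: "B $$ (k, j) = a k j" if "k < m" "j < s" for k j
    using that assms by (simp add: a_def mat_of_cols_def)
  have LB: "lawrence_moves (\<lambda>k j. B $$ (k, j)) m r s = lawrence_moves a m r s"
    using AB by (auto simp: lawrence_moves_def)
  let ?X = "block_rows r n"
  have XU: "?X (- v) = - ?X v" if "dim_vec v = r * n" for v using block_rows_uminus that .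
  have univA: "lawrence_universal_markov r A = up_to_sign (?X ` big.indecomposable)"
    using lawrence_universal_markov_eq[of r A] by (simp add: dims a_def)
  have "lawrence_universal_markov r B =
      up_to_sign (block_rows r s ` small.indecomposable)"
    using lawrence_universal_markov_eq[of r B] by (simp add: dims LB)
  moreover have "append_zero_cols n (- block_rows r s v) = - ?X (embed v)"
    if "v \<in> small.indecomposable" for v
  proof -
    have d: "dim_vec v = r * s" using that small.dim_lattice by (simp add: small.indecomposable_def)
    have "append_zero_cols n (- block_rows r s v) = ?X (embed (- v))"
      using d by (simp add: append_zero_cols_block_rows flip: block_rows_uminus)
    also have "\<dots> = - ?X (embed v)" using d by (simp add: embed_uminus XU)
    finally show ?thesis .
  qed
  ultimately have lhs: "(\<lambda>c. append_zero_cols n ` c) ` lawrence_universal_markov r B =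
      up_to_sign (?X ` embed ` small.indecomposable)"
    by (simp add: up_to_sign_def image_image append_zero_cols_block_rows cong: image_cong)
  have latB: "append_zero_cols n ` lawrence_lattice r B = ?X ` embed ` lawrence_moves a m r s"
    by (simp add: lawrence_lattice_def kernel_lawrence_lifting dims LB image_image
        append_zero_cols_block_rows)
  show ?thesis unfolding lhs univA latB
  proof (intro equalityI subsetI IntI)
    fix c assume "c \<in> up_to_sign (?X ` embed ` small.indecomposable)"
    then obtain v where v: "v \<in> small.indecomposable" "c = {?X (embed v), - ?X (embed v)}"
      by (auto simp: up_to_sign_def)
    have vL: "v \<in> lawrence_moves a m r s" using v(1) by (simp add: small.indecomposable_def)
    show "c \<in> up_to_sign (?X ` big.indecomposable)"
      using v embed_indecomposable_iff[OF vL] by (auto simp: up_to_sign_def)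
    show "c \<in> up_to_sign (?X ` embed ` lawrence_moves a m r s)"
      using v(2) vL by (auto simp: up_to_sign_def)
  next
    fix c assume "c \<in> up_to_sign (?X ` big.indecomposable) \<inter>
      up_to_sign (?X ` embed ` lawrence_moves a m r s)"
    then obtain u w where u: "u \<in> big.indecomposable" "c = {?X u, - ?X u}"
      and w: "w \<in> lawrence_moves a m r s" "c = {?X (embed w), - ?X (embed w)}"
      by (auto simp: up_to_sign_def)
    have du: "dim_vec u = r * n" using u(1) big.dim_lattice by (simp add: big.indecomposable_def)
    have dw: "dim_vec w = r * s" using w(1) small.dim_lattice by simp
    \<comment> \<open>Equal sign classes determine their representatives only up to sign.\<close>
    have "?X u = ?X (embed w) \<or> ?X u = ?X (embed (- w))"
      using u(2) w(2) dw by (auto simp: embed_uminus XU doubleton_eq_iff)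
    hence "u = embed w \<or> u = embed (- w)"
      using block_rows_inject[OF du] by auto
    then obtain w' where w': "w' \<in> lawrence_moves a m r s" "u = embed w'"
      using w(1) small.uminus_closed by blast
    hence "w' \<in> small.indecomposable" using u(1) embed_indecomposable_iff by simp
    thus "c \<in> up_to_sign (?X ` embed ` small.indecomposable)"
      using u(2) w'(2) by (auto simp: up_to_sign_def)
  qed
qed

end
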